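(* Let $q=2^m$ with $m\ge 3$, put $n=q+1$ and $K=\mathbb{F}_{q^2}$, let $U_n=\{t\in K^\times: t^n=1\}$, and for $a\in(\mathbb{Z}/n\mathbb{Z})^\times$ let $$\mathcal M_a=\{[1:t:t^a:t^{a+1}]: t\in U_n\}\subset\mathrm{PG}(3,K).$$ For an integer $e$ with $\gcd(e,m)=1$ let $A_e=\{[1:t:t^{2^e}:t^{2^e+1}]: t\in\mathbb{F}_q\}\cup\{[0:0:0:1]\}\subset\mathrm{PG}(3,q)$. For $a\in(\mathbb{Z}/n\mathbb{Z})^\times$ the following are equivalent: (i) $\mathcal M_a$ is projectively equivalent over $K$ to a $(q+1)$-arc contained in $\mathrm{PG}(3,q)$; (ii) $\mathcal M_a$ is projectively equivalent over $K$ to $A_e$ for some $e$ with $\gcd(e,m)=1$; (iii) there exists $e$ with $\gcd(e,m)=1$ such that $a\equiv\pm 2^e\pmod n$.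
   Context: A $(q+1)$-arc in $\mathrm{PG}(3,q)$ is a set of $q+1$ points no four of which lie in a common plane. $\mathrm{PG}(3,q)$ is viewed as a subset of $\mathrm{PG}(3,K)$; two point sets are projectively equivalent over $K$ if one is the image of the other under an element of $\mathrm{PGL}(4,K)$. *)

theory Defs
  imports
    "HOL-Analysis.Cartesian_Space"
    "HOL-Number_Theory.Modular_Inverse"
begin

definition proj_point :: "'k::field ^ 4 \<Rightarrow> ('k ^ 4) set" where
  "proj_point v = vec.span {v}"

text \<open>
  For a subfield \<open>F\<close> of \<open>'k\<close>, \<open>PG3 F\<close> is the space PG(3,F) viewed inside \<open>PG3 UNIV\<close> = PG(3,'k):
  the points having a representative with coordinates in \<open>F\<close>.
\<close>

definition PG3 :: "'k::field set \<Rightarrow> ('k ^ 4) set set" where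
  "PG3 F = {proj_point v | v. v \<noteq> 0 \<and> (\<forall>i. v $ i \<in> F)}"

definition PG3_planes :: "'k::field set \<Rightarrow> ('k ^ 4) set set set" where
  "PG3_planes F =
     {{P \<in> PG3 F. \<forall>x\<in>P. (\<Sum>i\<in>UNIV. u $ i * x $ i) = 0} | u. u \<noteq> 0 \<and> (\<forall>i. u $ i \<in> F)}"

definition is_arc :: "'k::field set \<Rightarrow> nat \<Rightarrow> ('k ^ 4) set set \<Rightarrow> bool" where
  "is_arc F k S \<longleftrightarrow>
     S \<subseteq> PG3 F \<and> finite S \<and> card S = k \<and>
     (\<forall>T\<subseteq>S. card T = 4 \<longrightarrow> \<not> (\<exists>H\<in>PG3_planes F. T \<subseteq> H))"

text \<open>
  An element of PGL(4,'k) is the class of an invertible matrix modulo scalars; its action on points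
  is that of any representing matrix.
\<close>

definition proj_equiv :: "('k::field ^ 4) set set \<Rightarrow> ('k ^ 4) set set \<Rightarrow> bool" where
  "proj_equiv S T \<longleftrightarrow>
     (\<exists>A :: 'k ^ 4 ^ 4. invertible A \<and> T = (\<lambda>P. (\<lambda>x. A *v x) ` P) ` S)"

text \<open>In a field with \<open>q\<^sup>2\<close> elements, this is the unique subfield with \<open>q\<close> elements.\<close>

definition subfield_q :: "nat \<Rightarrow> 'k::field set" where
  "subfield_q q = {x. x ^ q = x}"

definition roots_U :: "nat \<Rightarrow> 'k::field set" where
  "roots_U n = {t. t \<noteq> 0 \<and> t ^ n = 1}"

text \<open>
  The residue class \<open>a\<close> is given by an arbitrary integer representative; as \<open>t ^ n = 1\<close>, the integer
  power \<open>t powi a\<close> depends only on the class.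
\<close>

definition monomial_set :: "nat \<Rightarrow> int \<Rightarrow> ('k::field ^ 4) set set" where
  "monomial_set n a = {proj_point (vector [1, t, t powi a, t powi (a + 1)]) | t. t \<in> roots_U n}"

text \<open>
  \<open>frob e t\<close> is \<open>t\<close> to the power \<open>2\<^sup>e\<close> for an arbitrary integer \<open>e\<close>. For negative \<open>e\<close> it is the
  corresponding power of the inverse of the Frobenius automorphism of a finite field of
  characteristic 2.
\<close>

definition frob :: "int \<Rightarrow> 'k::field \<Rightarrow> 'k" where
  "frob e t = (if 0 \<le> e then t ^ (2 ^ nat e) else inv (\<lambda>s. s ^ (2 ^ nat (- e))) t)"

definition arc_A :: "nat \<Rightarrow> int \<Rightarrow> ('k::field ^ 4) set set" where
  "arc_A q e =
     {proj_point (vector [1, t, frob e t, frob e t * t]) | t. t \<in> subfield_q q} \<union>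
     {proj_point (vector [0, 0, 0, 1])}"

text \<open>
  A representative of the class of \<open>2\<^sup>e\<close> modulo the odd number \<open>n\<close>, for an arbitrary integer \<open>e\<close>;
  negative powers are powers of the inverse of 2 modulo \<open>n\<close>.
\<close>

definition two_power_mod :: "nat \<Rightarrow> int \<Rightarrow> int" where
  "two_power_mod n e =
     (if 0 \<le> e then 2 ^ nat e else modular_inverse (int n) 2 ^ nat (- e))"

end

theory Submission
  imports Defs "HOL-Computational_Algebra.Polynomial"
begin

text \<open>
  Suppose that no four points of the monomial set are coplanar, and replace a by -a if necessary to
  make its representative in {1..q} even. Projecting from the point with parameter 1, the slopes of
  the lines joining the image of the point with parameter s to the other images are pairwise
  distinct and, up to a common factor, fill the multiplicative group of the subfield of order q, so
  they sum to 0. With R(t) = (t^a + 1)/(t + 1) this says that the sum of R(t/s)/R(t) over the t in U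
  other than 1 and s vanishes. Let b in {1..q} be the even representative of plus or minus the
  inverse of a. Both R and 1/R are geometric sums, of length a and b; expanding them and applying
  the orthogonality relations on U shows that no number 1 + i + a*j with i < a and j < b is a
  multiple of n if a*b = -1 modulo n, while a*b = 1 is impossible. These numbers fill {1..a*b}, so
  a*b < n, hence a*b = q and a is a power of two. This replaces the classification of arcs by
  Casse and Glynn. If the exponent of two had a common factor d > 1 with m, an element of the field
  of order 2^d outside the prime field would give four coplanar points.
\<close>

section \<open>Roots of unity in a finite field\<close>

lemma finite_field_power_card_minus_one:
  fixes x :: "'k::{field,finite}"
  assumes "x \<noteq> 0"
  shows "x ^ (CARD('k) - 1) = 1"
proof -
  let ?N = "UNIV - {0::'k}"
  have "(\<lambda>y. x * y) ` ?N = ?N"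
  proof (rule card_subset_eq)
    show "(\<lambda>y. x * y) ` ?N \<subseteq> ?N" using assms by auto
    show "card ((\<lambda>y. x * y) ` ?N) = card ?N"
      by (rule card_image) (use assms in \<open>auto simp: inj_on_def\<close>)
  qed simp
  then have "\<Prod>?N = (\<Prod>y\<in>?N. x * y)"
    using prod.reindex[of "\<lambda>y. x * y" ?N "\<lambda>y. y"] assms by (auto simp: inj_on_def)
  also have "\<dots> = x ^ card ?N * \<Prod>?N"
    by (simp add: prod.distrib)
  finally have "x ^ card ?N = 1"
    by simp
  then show ?thesis by (simp add: card_Diff_singleton)
qed

lemma card_power_eq_le:
  fixes c :: "'k::{field,finite}"
  assumes "d > 0"
  shows "card {x. x ^ d = c} \<le> d"
proof -
  let ?p = "Polynomial.monom 1 d - [:c:]"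
  have "coeff ?p d = 1"
    using assms by (cases d) auto
  then have ne: "?p \<noteq> 0" by force
  have "{x. x ^ d = c} = {x. poly ?p x = 0}"
    by (auto simp: poly_monom)
  also have "card \<dots> \<le> degree ?p"
    by (rule card_poly_roots_bound[OF ne])
  also have "\<dots> \<le> d"
    by (intro degree_diff_le degree_monom_le) auto
  finally show ?thesis .
qed

text \<open>The power map with exponent \<open>d'\<close> carries the nonzero elements into the
  \<open>d\<close>-th roots of unity, and each fibre has at most \<open>d'\<close> elements. So
  there are at least \<open>d\<close> roots, and a polynomial of degree \<open>d\<close> has no
  more.\<close>

lemma card_roots_U:
  assumes "CARD('k::{field,finite}) - 1 = d * d'"
  shows "card (roots_U d :: 'k set) = d"
proof -
  have "CARD('k) > 1"
    using card_mono[of UNIV "{0,1::'k}"] by auto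
  with assms have pos: "d > 0" "d' > 0"
    by (auto intro: Nat.gr0I)
  let ?N = "UNIV - {0::'k}"
  have "card ?N \<le> d' * card (roots_U d :: 'k set)"
  proof -
    have "?N = (\<Union>c\<in>roots_U d. {x. x ^ d' = c} \<inter> ?N)"
      using finite_field_power_card_minus_one[where 'k='k] assms
      by (auto simp: roots_U_def power_mult[symmetric] mult.commute)
    then have "card ?N = card (\<Union>c\<in>roots_U d. {x. x ^ d' = c} \<inter> ?N)"
      by simp
    also have "\<dots> \<le> (\<Sum>c\<in>roots_U d. card ({x. x ^ d' = c} \<inter> ?N))"
      by (rule card_UN_le) auto
    also have "\<dots> \<le> (\<Sum>c\<in>(roots_U d :: 'k set). d')"
      by (intro sum_mono order.trans[OF card_mono card_power_eq_le[OF pos(2)]]) auto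
    finally show ?thesis by (simp add: mult.commute)
  qed
  moreover have "card ?N = d * d'"
    using assms by (simp add: card_Diff_singleton)
  ultimately have "d \<le> card (roots_U d :: 'k set)"
    using pos by (simp add: mult.commute)
  moreover have "card (roots_U d :: 'k set) \<le> card {x::'k. x ^ d = 1}"
    by (rule card_mono) (auto simp: roots_U_def)
  ultimately show ?thesis
    using card_power_eq_le[OF pos(1), of "1::'k"] by linarith
qed

lemma roots_U_closed:
  assumes "x \<in> roots_U d" "y \<in> roots_U d"
  shows "x * y \<in> roots_U d" "inverse x \<in> roots_U d" "x / y \<in> roots_U d" "x ^ i \<in> roots_U d"
proof -
  have "(x ^ i) ^ d = (x ^ d) ^ i"
    by (simp flip: power_mult add: mult.commute)
  then have "(x ^ i) ^ d = 1"
    using assms(1) by (simp add: roots_U_def)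
  then show "x ^ i \<in> roots_U d"
    using assms by (auto simp: roots_U_def)
qed (use assms in \<open>auto simp: roots_U_def power_mult_distrib power_inverse power_divide\<close>)

lemma roots_U_power_cong:
  assumes "t \<in> roots_U d" "[i = j] (mod d)"
  shows "t ^ i = t ^ j"
proof -
  have *: "t ^ i = t ^ (i mod d)" for i
  proof -
    have "t ^ i = t ^ (d * (i div d) + i mod d)" by simp
    also have "\<dots> = t ^ (i mod d)"
      unfolding power_add power_mult using assms(1) by (simp add: roots_U_def)
    finally show ?thesis .
  qed
  show ?thesis
    using *[of i] *[of j] assms(2) by (simp add: cong_def)
qed

lemma roots_U_powi_cong:
  assumes "t \<in> roots_U d" "[i = j] (mod int d)"
  shows "t powi i = t powi j"
proof -
  from assms(2) obtain k where k: "i = j + int d * k"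
    by (metis cong_iff_lin cong_sym)
  have "t powi i = t powi j * (t powi int d) powi k"
    using assms(1) by (simp add: k roots_U_def power_int_add power_int_mult)
  then show ?thesis
    using assms(1) by (simp add: roots_U_def)
qed

text \<open>Multiplication by a root of unity \<open>z\<close> permutes the roots and multiplies the
  sum by \<open>z ^ i\<close>, so the sum vanishes as soon as \<open>z ^ i\<close> differs from 1
  for some \<open>z\<close>.\<close>

lemma sum_roots_U_power:
  assumes "card (roots_U d :: 'k::{field,finite} set) = d" "d > 0"
  shows "(\<Sum>t\<in>(roots_U d :: 'k set). t ^ i) = (if d dvd i then of_nat d else 0)"
proof (cases "d dvd i")
  case True
  then have "t ^ i = 1" if "t \<in> roots_U d" for t :: 'k
    using roots_U_power_cong[OF that, of i 0] by (simp add: cong_0_iff)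
  then show ?thesis using True assms by simp
next
  case False
  let ?U = "roots_U d :: 'k set"
  \<comment> \<open>Otherwise a polynomial of positive degree \<open>i mod d < d\<close> would have
    \<open>d\<close> zeros.\<close>
  have "\<exists>z\<in>?U. z ^ i \<noteq> 1"
  proof (rule ccontr)
    assume "\<not> ?thesis"
    moreover have "z ^ (i mod d) = z ^ i" if "z \<in> ?U" for z
      by (rule roots_U_power_cong[OF that]) simp
    ultimately have "?U \<subseteq> {z. z ^ (i mod d) = 1}" by auto
    then have "d \<le> card {z::'k. z ^ (i mod d) = 1}"
      using card_mono[of "{z. z ^ (i mod d) = 1}" ?U] assms by simp
    also have "\<dots> \<le> i mod d"
      by (rule card_power_eq_le) (use False in \<open>simp add: mod_greater_zero_iff_not_dvd\<close>)
    finally show False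
      using mod_less_divisor[OF assms(2), of i] by simp
  qed
  then obtain z where z: "z \<in> ?U" "z ^ i \<noteq> 1" by blast
  then have nz: "z \<noteq> 0" by (simp add: roots_U_def)
  have "(\<Sum>t\<in>?U. t ^ i) = (\<Sum>t\<in>?U. (z * t) ^ i)"
    by (rule sum.reindex_bij_witness[of _ "\<lambda>t. z * t" "\<lambda>t. t / z"])
       (use z nz roots_U_closed in auto)
  also have "\<dots> = z ^ i * (\<Sum>t\<in>?U. t ^ i)"
    by (simp add: power_mult_distrib sum_distrib_left)
  finally have "(z ^ i - 1) * (\<Sum>t\<in>?U. t ^ i) = 0"
    by (simp add: algebra_simps)
  then show ?thesis using z(2) False by simp
qed

text \<open>A nonzero polynomial of degree less than \<open>d\<close> has fewer than
  \<open>d\<close> zeros. This form will separate the powers of \<open>s\<close> in the expanded sum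
  of slopes.\<close>

lemma power_sum_eq_zero_on_imp_coeff_eq_zero:
  fixes c :: "nat \<Rightarrow> 'k::{field,finite}"
  assumes "\<And>x. x \<in> X \<Longrightarrow> (\<Sum>i<d. c i * x ^ i) = 0" "d \<le> card X" "i < d"
  shows "c i = 0"
proof (rule ccontr)
  assume nz: "c i \<noteq> 0"
  define p where "p = (\<Sum>i<d. Polynomial.monom (c i) i)"
  have cf: "coeff p j = (if j < d then c j else 0)" for j
    by (auto simp: p_def coeff_sum if_distrib cong: if_cong)
  then have ne: "p \<noteq> 0"
    using nz assms(3) by (metis coeff_0)
  have "X \<subseteq> {x. poly p x = 0}"
    using assms(1) by (auto simp: p_def poly_sum poly_monom)
  then have "card X \<le> card {x. poly p x = 0}"
    by (intro card_mono) auto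
  also have "\<dots> \<le> degree p"
    by (rule card_poly_roots_bound[OF ne])
  also have "degree p \<le> d - 1"
    by (rule degree_le) (auto simp: cf)
  finally show False using assms(2,3) by linarith
qed

section \<open>Points and planes\<close>

lemma vector_4 [simp]:
  "(vector [w, x, y, z] :: 'k::zero ^ 4) $ 1 = w"
  "(vector [w, x, y, z] :: 'k::zero ^ 4) $ 2 = x"
  "(vector [w, x, y, z] :: 'k::zero ^ 4) $ 3 = y"
  "(vector [w, x, y, z] :: 'k::zero ^ 4) $ 4 = z"
  unfolding vector_def by simp_all

lemma vec4_eq_iff: "(v :: 'k ^ 4) = w \<longleftrightarrow> v$1 = w$1 \<and> v$2 = w$2 \<and> v$3 = w$3 \<and> v$4 = w$4"
  by (simp add: vec_eq_iff forall_4)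

lemma proj_point_eq_range: "proj_point v = range (\<lambda>c. c *s v)"
  by (simp add: proj_point_def vec.span_singleton)

lemma proj_point_scale:
  assumes "c \<noteq> 0"
  shows "proj_point (c *s v) = proj_point v"
proof -
  have "d *s v = (d / c) *s (c *s v)" for d
    using assms by (simp add: vector_smult_assoc)
  then show ?thesis
    unfolding proj_point_eq_range image_def by (metis (no_types, lifting) UNIV_I vector_smult_assoc)
qed

lemma image_proj_point: "(\<lambda>x. A *v x) ` proj_point v = proj_point (A *v v)"
  unfolding proj_point_eq_range image_image by (simp add: vector_scalar_commute)

lemma proj_point_normalized_inj:
  assumes "proj_point v = proj_point w" "v $ i = 1" "w $ i = 1"
  shows "v = w"
proof -
  have "v \<in> proj_point w"
    using assms(1) by (metis proj_point_def vec.span_base singletonI)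
  then obtain c where "v = c *s w"
    by (auto simp: proj_point_eq_range)
  with assms(2,3) show ?thesis by auto
qed

lemma proj_point_in_plane_iff:
  fixes u v :: "'k::field ^ 4"
  shows "(\<forall>x\<in>proj_point v. (\<Sum>i\<in>UNIV. u $ i * x $ i) = 0) \<longleftrightarrow> (\<Sum>i\<in>UNIV. u $ i * v $ i) = 0"
proof -
  have "(\<Sum>i\<in>UNIV. u $ i * (c *s v) $ i) = c * (\<Sum>i\<in>UNIV. u $ i * v $ i)" for c
    by (simp add: sum_distrib_left mult_ac)
  then show ?thesis
    unfolding proj_point_eq_range by (auto simp: image_iff intro: exI[of _ 1])
qed

lemma proj_equiv_trans:
  assumes "proj_equiv S T" "proj_equiv T W"
  shows "proj_equiv S (W :: ('k::field ^ 4) set set)"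
proof -
  from assms obtain A B :: "'k ^ 4 ^ 4" where
    "invertible A" "T = (\<lambda>P. (\<lambda>x. A *v x) ` P) ` S"
    "invertible B" "W = (\<lambda>P. (\<lambda>x. B *v x) ` P) ` T"
    by (auto simp: proj_equiv_def)
  then have "invertible (B ** A) \<and> W = (\<lambda>P. (\<lambda>x. (B ** A) *v x) ` P) ` S"
    by (auto simp: invertible_mult image_image matrix_vector_mul_assoc)
  then show ?thesis unfolding proj_equiv_def by blast
qed


section \<open>The field of order q squared\<close>

locale quadratic_extension_char_2 =
  fixes m q n :: nat and ty :: "'k::{field,finite} itself"
  assumes m_ge: "m \<ge> 3" and q_def: "q = 2 ^ m" and n_def: "n = q + 1"
    and card_field: "CARD('k) = q ^ 2"
begin

abbreviation U :: "'k set" where "U \<equiv> roots_U n"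
abbreviation Fq :: "'k set" where "Fq \<equiv> subfield_q q"

lemma q_ge: "q \<ge> 8"
  using power_increasing[OF m_ge, of "2::nat"] by (simp add: q_def)

lemma even_q: "even q"
  using m_ge by (simp add: q_def)

section \<open>Characteristic 2 and additivity of the Frobenius map\<close>

lemma two_eq_zero: "(2::'k) = 0"
proof -
  \<comment> \<open>Translation by 1 permutes the field, so a sum of \<open>CARD('k)\<close> ones is
    0, and \<open>CARD('k)\<close> is a power of two.\<close>
  have "(\<Sum>x\<in>(UNIV::'k set). x) = (\<Sum>x\<in>UNIV. x + 1)"
    by (rule sum.reindex_bij_witness[of _ "\<lambda>x. x + 1" "\<lambda>x. x - 1"]) auto
  also have "\<dots> = (\<Sum>x\<in>UNIV. x) + of_nat (CARD('k))"
    by (simp add: sum.distrib)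
  finally have "of_nat (CARD('k)) = (0::'k)" by simp
  then have "((2::'k) ^ m) ^ 2 = 0"
    by (simp add: card_field q_def)
  then show ?thesis by (simp only: power_eq_0_iff)
qed

lemma add_self [simp]: "x + x = (0::'k)"
  by (metis mult_2 mult_zero_left two_eq_zero)

lemma add_self_left [simp]: "x + (x + y) = (y::'k)"
  by (simp flip: add.assoc)

lemma add_eq_0_iff_eq: "x + y = 0 \<longleftrightarrow> x = (y::'k)"
  by (metis add_self add_left_cancel)

lemma diff_eq_add: "x - y = x + (y::'k)"
  using minus_unique[OF add_self[of y]] by (simp add: diff_conv_add_uminus del: add_uminus_conv_diff)

lemma of_nat_even: "even i \<Longrightarrow> of_nat i = (0::'k)"
  by (auto simp: two_eq_zero elim!: evenE)

lemma of_nat_odd: "odd i \<Longrightarrow> of_nat i = (1::'k)"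
  by (auto simp: two_eq_zero elim!: oddE)

lemma frobenius_add: "(x + y :: 'k) ^ (2 ^ f) = x ^ (2 ^ f) + y ^ (2 ^ f)"
proof (induction f)
  case (Suc f)
  have "(x + y) ^ (2 ^ Suc f) = ((x + y) ^ (2 ^ f))\<^sup>2"
    by (simp add: power_mult[symmetric] mult.commute)
  also have "\<dots> = (x ^ (2 ^ f))\<^sup>2 + (y ^ (2 ^ f))\<^sup>2"
    by (simp add: Suc power2_sum two_eq_zero)
  finally show ?case
    by (simp add: power_mult[symmetric] mult.commute)
qed simp

lemma power_q_add: "(x + y :: 'k) ^ q = x ^ q + y ^ q"
  unfolding q_def by (rule frobenius_add)

section \<open>The group \<open>U\<close> and the subfield of order \<open>q\<close>\<close>

lemma card_field_minus_one: "CARD('k) - 1 = n * (q - 1)"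
  using q_ge by (simp add: card_field n_def power2_eq_square algebra_simps)

lemma card_U: "card U = n"
  by (rule card_roots_U[OF card_field_minus_one])

lemma power_field_card: "(x::'k) ^ (q ^ 2) = x"
proof (cases "x = 0")
  case False
  have "q ^ 2 = Suc (CARD('k) - 1)"
    using q_ge by (simp add: card_field)
  then have "x ^ (q ^ 2) = x * x ^ (CARD('k) - 1)"
    by (simp only: power_Suc)
  then show ?thesis
    using finite_field_power_card_minus_one[OF False] by simp
qed (use q_ge in simp)

lemma nonzero_in_Fq_iff: "x \<noteq> 0 \<Longrightarrow> x \<in> Fq \<longleftrightarrow> x \<in> roots_U (q - 1)"
  using q_ge by (cases q) (auto simp: subfield_q_def roots_U_def)

lemma Fq_eq: "Fq = insert 0 (roots_U (q - 1))"
proof -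
  have "0 \<in> Fq" using q_ge by (simp add: subfield_q_def)
  moreover have "0 \<notin> (roots_U (q - 1) :: 'k set)" by (simp add: roots_U_def)
  ultimately show ?thesis
    by (intro set_eqI) (metis insert_iff nonzero_in_Fq_iff)
qed

lemma card_roots_q_minus_one: "card (roots_U (q - 1) :: 'k set) = q - 1"
  by (rule card_roots_U[of _ n]) (simp only: card_field_minus_one mult.commute)

lemma card_Fq: "card Fq = q"
  using card_roots_q_minus_one q_ge unfolding Fq_eq by (simp add: roots_U_def)

lemma Fq_0 [simp]: "0 \<in> Fq" and Fq_1 [simp]: "1 \<in> Fq"
  using q_ge by (auto simp: subfield_q_def)

lemma Fq_add: "x \<in> Fq \<Longrightarrow> y \<in> Fq \<Longrightarrow> x + y \<in> Fq"
  by (simp add: subfield_q_def power_q_add)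

lemma Fq_mult: "x \<in> Fq \<Longrightarrow> y \<in> Fq \<Longrightarrow> x * y \<in> Fq"
  by (simp add: subfield_q_def power_mult_distrib)

lemma Fq_divide: "x \<in> Fq \<Longrightarrow> y \<in> Fq \<Longrightarrow> x / y \<in> Fq"
  by (simp add: subfield_q_def power_divide)

lemma Fq_power: "x \<in> Fq \<Longrightarrow> x ^ i \<in> Fq"
  by (induction i) (auto intro: Fq_mult)

lemma one_in_U [simp]: "1 \<in> U"
  by (simp add: roots_U_def)

lemma U_nonzero: "t \<in> U \<Longrightarrow> t \<noteq> 0"
  by (simp add: roots_U_def)

lemma U_power_q: "t \<in> U \<Longrightarrow> t ^ q = inverse t"
  by (simp add: roots_U_def n_def inverse_eq_divide field_simps)

text \<open>
  The map sending t to 1/(t+1) carries U without 1 to the elements with trace 1 over the subfield,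
  a coset of the subfield.
\<close>

lemma inverse_U_trace_one:
  assumes "t \<in> U" "t \<noteq> 1"
  shows "(1 / (t + 1)) ^ q = 1 / (t + 1) + 1"
proof -
  have nz: "t \<noteq> 0" "t + 1 \<noteq> 0"
    using assms by (auto simp: U_nonzero add_eq_0_iff_eq)
  have "(1 / (t + 1)) ^ q = 1 / (inverse t + 1)"
    by (simp add: power_divide power_q_add U_power_q[OF assms(1)])
  also have "\<dots> = t / (t + 1)"
    using nz by (simp add: field_simps)
  also have "\<dots> = 1 / (t + 1) + 1"
    using nz by (simp add: field_simps)
  finally show ?thesis .
qed

text \<open>Inverts the correspondence of \<open>inverse_U_trace_one\<close>: in characteristic 2,
  solving \<open>u = 1 / (t + 1)\<close> for \<open>t\<close> gives
  \<open>1 + 1 / u\<close>.\<close>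

lemma trace_one_in_U:
  assumes "u ^ q = u + (1::'k)"
  shows "1 + 1 / u \<in> U" "1 + 1 / u \<noteq> 1" "u \<noteq> 0"
proof -
  show nz: "u \<noteq> 0" using assms q_ge by (auto simp: power_0_left)
  have nz1: "u + 1 \<noteq> 0"
    using assms nz by auto
  have "(1 + 1 / u) ^ q = u / (u + 1)"
    using nz nz1 by (simp add: power_q_add power_divide assms field_simps)
  then have "(1 + 1 / u) ^ n = 1"
    using nz nz1 by (simp add: n_def field_simps)
  moreover have "1 + 1 / u \<noteq> 0"
    using nz nz1 by (simp add: field_simps)
  ultimately show "1 + 1 / u \<in> U" by (simp add: roots_U_def)
  show "1 + 1 / u \<noteq> 1" using nz by simp
qed

text \<open>Such an \<open>l\<close> is a base point for the coset of elements of trace 1; adding it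
  moves this coset to the subfield.\<close>

lemma obtain_trace_one:
  obtains l :: 'k where "l ^ q = l + 1"
proof -
  have "\<not> U \<subseteq> {1}"
    using card_mono[of "{1}" U] card_U q_ge by (auto simp: n_def)
  then obtain t where "t \<in> U" "t \<noteq> 1" by blast
  then show ?thesis using inverse_U_trace_one that by blast
qed

lemma sum_U_power: "(\<Sum>t\<in>U. t ^ i) = (if n dvd i then 1 else 0)"
  using sum_roots_U_power[OF card_U, of i] even_q of_nat_odd[of n] by (simp add: n_def)

lemma U_power_inj:
  assumes "coprime a n" "t \<in> U" "s \<in> U" "t ^ a = s ^ a"
  shows "t = s"
proof -
  obtain b where b: "[a * b = 1] (mod n)"
    using cong_solve_coprime_nat[OF assms(1)] by auto
  have "x ^ (a * b) = x" if "x \<in> U" for x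
    using roots_U_power_cong[OF that b] by simp
  then show ?thesis
    using assms(2-4) by (metis power_mult)
qed

section \<open>Exponents of arcs are powers of two\<close>

text \<open>The coefficients describe a plane over all of \<open>'k\<close>, not only over the
  subfield; coplanarity in this sense is invariant under projective equivalence over
  \<open>'k\<close>, so it can be stated in the parameters alone.\<close>

definition no_four_coplanar :: "nat \<Rightarrow> bool" where
  "no_four_coplanar a \<longleftrightarrow> (\<forall>(T :: 'k set) c0 c1 c2 c3. T \<subseteq> U \<longrightarrow> card T = 4 \<longrightarrow>
     (\<forall>t\<in>T. c0 + c1 * t + c2 * t ^ a + c3 * t ^ (a + 1) = 0) \<longrightarrow>
     c0 = 0 \<and> c1 = 0 \<and> c2 = 0 \<and> c3 = 0)"

context
  fixes a :: nat
  assumes coprime_a: "coprime a n" and arc: "no_four_coplanar a"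
begin

lemma four_coplanarD:
  fixes c0 c1 c2 c3 :: 'k
  assumes "T \<subseteq> U" "card T = 4"
    and "\<And>t. t \<in> T \<Longrightarrow> c0 + c1 * t + c2 * t ^ a + c3 * t ^ (a + 1) = 0"
  shows "c0 = 0 \<and> c1 = 0 \<and> c2 = 0 \<and> c3 = 0"
  using arc assms unfolding no_four_coplanar_def by blast

lemma U_power_add_nonzero: "t \<in> U \<Longrightarrow> s \<in> U \<Longrightarrow> t \<noteq> s \<Longrightarrow> t ^ a + s ^ a \<noteq> 0"
  using U_power_inj[OF coprime_a] by (auto simp: add_eq_0_iff_eq)

lemma U_power_add_one_nonzero: "t \<in> U \<Longrightarrow> t \<noteq> 1 \<Longrightarrow> t ^ a + 1 \<noteq> 0"
  using U_power_add_nonzero[of t 1] by simp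

text \<open>
  After projection from the point with parameter 1, the value below is, up to a constant factor, the
  slope of the line through the points with parameters s and t.
\<close>

lemma slope_inj:
  assumes "s \<in> U" "s \<noteq> 1"
  shows "inj_on (\<lambda>t. (t ^ a + s ^ a) * (t + 1) / ((t + s) * (t ^ a + 1))) (U - {1, s})"
proof (rule inj_onI, rule ccontr)
  fix x y
  assume x: "x \<in> U - {1, s}" and y: "y \<in> U - {1, s}" and "x \<noteq> y"
    and eq: "(x ^ a + s ^ a) * (x + 1) / ((x + s) * (x ^ a + 1)) =
             (y ^ a + s ^ a) * (y + 1) / ((y + s) * (y ^ a + 1))"
  have nz: "x + s \<noteq> 0" "y + s \<noteq> 0" "x ^ a + 1 \<noteq> 0" "y ^ a + 1 \<noteq> 0"
    using x y assms U_power_add_one_nonzero by (auto simp: add_eq_0_iff_eq)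
  have eq': "(x ^ a + s ^ a) * (x + 1) * ((y + s) * (y ^ a + 1)) =
             (y ^ a + s ^ a) * (y + 1) * ((x + s) * (x ^ a + 1))"
    using eq nz by (simp add: frac_eq_eq)
  \<comment> \<open>The coefficients below come from expanding the right side of
    \<open>form\<close>. Its plane passes through the points with parameters 1, \<open>s\<close> and
    \<open>x\<close>; equality of the slopes puts the point with parameter \<open>y\<close> on it
    too.\<close>
  define A where "A = (x ^ a + s ^ a) * (x + 1)"
  define B where "B = (x + s) * (x ^ a + 1)"
  define c0 where "c0 = A * (s + 1) + B * (s ^ a + 1) + (A + B)"
  define c1 where "c1 = B * (s ^ a + 1) + (A + B)"
  define c2 where "c2 = A * (s + 1) + (A + B)"
  define c3 where "c3 = A + B"
  have form: "c0 + c1 * t + c2 * t ^ a + c3 * t ^ (a + 1) =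
        A * (t ^ a + 1) * (s + t) + B * (t + 1) * (s ^ a + t ^ a)" for t
    unfolding c0_def c1_def c2_def c3_def by (simp add: algebra_simps)
  have "c0 = 0 \<and> c1 = 0 \<and> c2 = 0 \<and> c3 = 0"
  proof (rule four_coplanarD)
    show "{1, s, x, y} \<subseteq> U" using assms x y by auto
    show "card {1, s, x, y} = 4" using assms x y \<open>x \<noteq> y\<close> by auto
    fix t assume "t \<in> {1, s, x, y}"
    then consider "t = 1" | "t = s" | "t = x" | "t = y" by blast
    then show "c0 + c1 * t + c2 * t ^ a + c3 * t ^ (a + 1) = 0"
      unfolding form
    proof cases
      case 3
      then show "A * (t ^ a + 1) * (s + t) + B * (t + 1) * (s ^ a + t ^ a) = 0"
        unfolding add_eq_0_iff_eq by (simp add: A_def B_def ac_simps)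
    next
      case 4
      then show "A * (t ^ a + 1) * (s + t) + B * (t + 1) * (s ^ a + t ^ a) = 0"
        unfolding add_eq_0_iff_eq using eq' by (simp add: A_def B_def ac_simps)
    qed auto
  qed
  then have "A * (s + 1) = 0" by (metis add_0_right c2_def c3_def)
  then show False
    using assms x U_power_add_nonzero[of x s] by (auto simp: A_def add_eq_0_iff_eq)
qed

lemma sum_slopes:
  assumes "s \<in> U" "s \<noteq> 1"
  shows "(\<Sum>t\<in>U - {1, s}. (t ^ a + s ^ a) * (t + 1) / ((t + s) * (t ^ a + 1))) = 0"
    (is "sum ?D ?V = 0")
proof -
  \<comment> \<open>With this factor \<open>r t\<close> becomes the quotient \<open>v / u\<close>
    below. Both \<open>v\<close> and \<open>u\<close> are sums of two elements of trace 1, hence lie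
    in the subfield.\<close>
  define k where "k = (s + 1) / (s ^ a + 1)"
  define r where "r t = k * ?D t" for t
  have k: "k \<noteq> 0"
    using assms U_power_add_one_nonzero[of s] by (auto simp: k_def add_eq_0_iff_eq)
  have r_in: "r t \<in> roots_U (q - 1)" if t: "t \<in> ?V" for t
  proof -
    have nz: "t + s \<noteq> 0" "t ^ a + 1 \<noteq> 0" "s ^ a + 1 \<noteq> 0" "t + 1 \<noteq> 0" "s + 1 \<noteq> 0"
       "t ^ a + s ^ a \<noteq> 0"
      using t assms U_power_add_one_nonzero[of t] U_power_add_one_nonzero[of s]
        U_power_add_nonzero[of t s] by (auto simp: add_eq_0_iff_eq)
    have ta: "t ^ a \<in> U" "s ^ a \<in> U" "t ^ a \<noteq> 1" "s ^ a \<noteq> 1"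
      using t assms nz by (auto simp: add_eq_0_iff_eq intro: roots_U_closed)
    define v where "v = 1 / (t ^ a + 1) + 1 / (s ^ a + 1)"
    define u where "u = 1 / (t + 1) + 1 / (s + 1)"
    have "v ^ q = (1 / (t ^ a + 1) + 1) + (1 / (s ^ a + 1) + 1)"
      by (simp only: v_def power_q_add inverse_U_trace_one ta not_False_eq_True)
    moreover have "u ^ q = (1 / (t + 1) + 1) + (1 / (s + 1) + 1)"
      using t assms unfolding u_def power_q_add
      by (subst (1 2) inverse_U_trace_one) auto
    ultimately have "v ^ q = v" "u ^ q = u"
      by (simp_all add: v_def u_def ac_simps)
    then have "v \<in> Fq" "u \<in> Fq" by (simp_all add: subfield_q_def)
    then have "v / u \<in> Fq" by (rule Fq_divide)
    moreover have "v = (t ^ a + s ^ a) / ((t ^ a + 1) * (s ^ a + 1))"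
      using nz by (simp add: v_def add_frac_eq ac_simps)
    moreover have "u = (t + s) / ((t + 1) * (s + 1))"
      using nz by (simp add: u_def add_frac_eq ac_simps)
    ultimately have "r t \<in> Fq"
      using nz by (simp add: r_def k_def ac_simps)
    moreover have "r t \<noteq> 0"
      using nz k by (simp add: r_def)
    ultimately show ?thesis by (simp add: nonzero_in_Fq_iff)
  qed
  have inj: "inj_on r ?V"
  proof (rule inj_onI)
    fix x y assume "x \<in> ?V" "y \<in> ?V" "r x = r y"
    moreover from \<open>r x = r y\<close> have "?D x = ?D y"
      using k unfolding r_def mult_cancel_left by blast
    ultimately show "x = y" using inj_onD[OF slope_inj[OF assms]] by blast
  qed
  \<comment> \<open>The \<open>n - 2 = q - 1\<close> values are distinct, so they exhaust the
    multiplicative group of the subfield. Its sum is 0, as \<open>q - 1\<close> does not divide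
    1.\<close>
  have "r ` ?V = roots_U (q - 1)"
  proof (rule card_subset_eq)
    show "card (r ` ?V) = card (roots_U (q - 1) :: 'k set)"
      unfolding card_image[OF inj] card_roots_q_minus_one
      using assms by (simp add: card_Diff_subset card_U) (simp add: n_def)
  qed (use r_in in auto)
  then have "sum r ?V = (\<Sum>x\<in>roots_U (q - 1). x)"
    using sum.reindex[OF inj, of "\<lambda>x. x"] by simp
  also have "\<dots> = 0"
    using sum_roots_U_power[OF card_roots_q_minus_one, of 1] q_ge by auto
  finally have "sum r ?V = 0" .
  moreover have "k * sum ?D ?V = sum r ?V"
    unfolding sum_distrib_left by (rule sum.cong[OF refl r_def[symmetric]])
  ultimately have "k * sum ?D ?V = 0"
    by (simp only:)
  then show ?thesis
    using k unfolding mult_eq_0_iff by blast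
qed

text \<open>
  With e = 0 the condition on b says a*b = 1 modulo n, and with e = 1 it says a*b = -1. The slopes
  become polynomials in s and t; as a and b are even, the terms for t = 1 and t = s that are
  missing from the sum of the slopes vanish, and the orthogonality relations for U apply.
\<close>

lemma not_dvd_exponents:
  assumes "a < n" "b < n" "even a" "even b"
    and e: "\<And>t. t \<in> U \<Longrightarrow> t ^ e * (t ^ (a * b) + 1) = t + 1"
    and "i < a" "j < b"
  shows "\<not> n dvd e + i + a * j"
proof
  assume dvd: "n dvd e + i + a * j"
  \<comment> \<open>\<open>P s t\<close> is the polynomial form of
    \<open>(t ^ a + s ^ a) / (t + s)\<close>. The geometric sum telescopes, so hypothesis
    \<open>e\<close> makes \<open>Q t\<close> equal to \<open>(t + 1) / (t ^ a + 1)\<close> for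
    \<open>t\<close> in \<open>U\<close> other than 1.\<close>
  define P where "P s t = (\<Sum>i<a. s ^ (a - Suc i) * t ^ i)" for s t :: 'k
  define Q where "Q t = t ^ e * (\<Sum>j<b. (t ^ a) ^ j)" for t :: 'k
  have P: "(t + s) * P s t = t ^ a + s ^ a" for s t
    using power_diff_sumr2[of t a s] by (simp add: P_def diff_eq_add)
  have Q: "(t ^ a + 1) * Q t = t + 1" if "t \<in> U" for t
    using e[OF that] power_diff_1_eq[of "t ^ a" b]
    by (simp add: Q_def diff_eq_add power_mult mult.left_commute)
  have Q1: "Q 1 = 0" using assms(4) by (simp add: Q_def of_nat_even)
  have Ps: "P s s = 0" for s
    using assms(3) by (simp add: P_def of_nat_even flip: power_add)
  have PQ: "P s t * Q t = (t ^ a + s ^ a) * (t + 1) / ((t + s) * (t ^ a + 1))"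
    if "t \<in> U" "t \<noteq> 1" "t \<noteq> s" for s t
  proof -
    have "t + s \<noteq> 0" "t ^ a + 1 \<noteq> 0"
      using that U_power_add_one_nonzero by (auto simp: add_eq_0_iff_eq)
    moreover have "(t ^ a + s ^ a) * (t + 1) = (P s t * Q t) * ((t + s) * (t ^ a + 1))"
      using P[of t s] Q[OF that(1)] by (metis mult.commute mult.left_commute)
    ultimately show ?thesis by (intro eq_divide_imp) auto
  qed
  have sum0: "(\<Sum>t\<in>U. P s t * Q t) = 0" if s: "s \<in> U" for s
  proof (cases "s = 1")
    case True
    have "(\<Sum>t\<in>U. P s t * Q t) = P s 1 * Q 1 + (\<Sum>t\<in>U - {1}. P s t * Q t)"
      by (rule sum.remove) auto
    \<comment> \<open>With \<open>s = 1\<close> every remaining term is 1, and there are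
      \<open>q\<close> of them, an even number.\<close>
    also have "(\<Sum>t\<in>U - {1}. P s t * Q t) = (\<Sum>t\<in>U - {1}. 1)"
    proof (rule sum.cong)
      fix t assume t: "t \<in> U - {1}"
      then have "t + 1 \<noteq> 0" "t ^ a + 1 \<noteq> 0"
        using U_power_add_one_nonzero by (auto simp: add_eq_0_iff_eq)
      then show "P s t * Q t = 1"
        using PQ[of t s] t True by simp
    qed simp
    also have "\<dots> = of_nat (n - 1)"
      by (simp add: card_Diff_singleton card_U)
    also have "\<dots> = 0"
      using even_q by (simp add: n_def of_nat_even)
    finally show ?thesis by (simp add: Q1)
  next
    case False
    have "(\<Sum>t\<in>U. P s t * Q t) = (\<Sum>t\<in>U - {1, s}. P s t * Q t) + (\<Sum>t\<in>{1, s}. P s t * Q t)"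
      by (rule sum.subset_diff) (use s in auto)
    also have "(\<Sum>t\<in>{1, s}. P s t * Q t) = 0"
      using False by (simp add: Q1 Ps)
    also have "(\<Sum>t\<in>U - {1, s}. P s t * Q t) =
        (\<Sum>t\<in>U - {1, s}. (t ^ a + s ^ a) * (t + 1) / ((t + s) * (t ^ a + 1)))"
      by (rule sum.cong) (auto intro: PQ)
    also have "\<dots> = 0" by (rule sum_slopes[OF s False])
    finally show ?thesis by simp
  qed
  \<comment> \<open>By orthogonality \<open>c i\<close> is the coefficient of
    \<open>s ^ (a - Suc i)\<close>; it counts, modulo 2, the \<open>j\<close> below \<open>b\<close>
    that satisfy the divisibility.\<close>
  define c where "c i = (\<Sum>j<b. if n dvd e + i + a * j then 1 else 0 :: 'k)" for i
  have expand: "(\<Sum>t\<in>U. P s t * Q t) = (\<Sum>i<a. s ^ (a - Suc i) * c i)" for s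
  proof -
    have pow: "t ^ (e + i + a * j) = t ^ i * (t ^ e * (t ^ a) ^ j)" for t :: 'k and i j
      by (simp add: power_add power_mult)
    have "(\<Sum>t\<in>U. P s t * Q t) =
        (\<Sum>t\<in>U. \<Sum>i<a. s ^ (a - Suc i) * (\<Sum>j<b. t ^ (e + i + a * j)))"
      unfolding P_def sum_distrib_right
      by (intro sum.cong refl) (simp only: Q_def pow sum_distrib_left mult.assoc)
    also have "\<dots> = (\<Sum>i<a. \<Sum>t\<in>U. s ^ (a - Suc i) * (\<Sum>j<b. t ^ (e + i + a * j)))"
      by (rule sum.swap)
    also have "\<dots> = (\<Sum>i<a. s ^ (a - Suc i) * (\<Sum>j<b. \<Sum>t\<in>U. t ^ (e + i + a * j)))"
      unfolding sum_distrib_left[symmetric] by (subst sum.swap) simp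
    also have "\<dots> = (\<Sum>i<a. s ^ (a - Suc i) * c i)"
      by (simp add: sum_U_power c_def)
    finally show ?thesis .
  qed
  have "(\<Sum>i<a. c (a - Suc i) * s ^ i) = 0" if "s \<in> U" for s
  proof -
    have "(\<Sum>i<a. c (a - Suc i) * s ^ i) = (\<Sum>i<a. s ^ (a - Suc i) * c i)"
      by (subst sum.nat_diff_reindex[symmetric]) (simp add: mult.commute)
    then show ?thesis using sum0[OF that] expand[of s] by simp
  qed
  \<comment> \<open>The polynomial in \<open>s\<close> has degree less than \<open>a < n\<close> and
    vanishes on all \<open>n\<close> elements of \<open>U\<close>.\<close>
  from power_sum_eq_zero_on_imp_coeff_eq_zero[where i = "a - Suc i", OF this]
  have "c i = 0" using assms(1,6) by (simp add: card_U)
  \<comment> \<open>As \<open>a\<close> is invertible modulo \<open>n\<close> and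
    \<open>b < n\<close>, only \<open>j' = j\<close> satisfies the divisibility, so
    \<open>c i\<close> is also 1.\<close>
  moreover have "c i = (\<Sum>j'<b. if j' = j then 1 else 0)"
    unfolding c_def
  proof (rule sum.cong)
    fix j' assume j': "j' \<in> {..<b}"
    have "n dvd e + i + a * j' \<longleftrightarrow> [e + i + a * j' = e + i + a * j] (mod n)"
      using dvd by (metis cong_dvd_iff cong_0_iff cong_sym cong_trans)
    also have "\<dots> \<longleftrightarrow> [j' = j] (mod n)"
      using coprime_a by (simp add: cong_add_lcancel_nat cong_mult_lcancel_nat)
    also have "\<dots> \<longleftrightarrow> j' = j"
      using j' assms(2,7) by (auto simp: cong_def)
    finally show "(if n dvd e + i + a * j' then 1 else 0 :: 'k) = (if j' = j then 1 else 0)"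
      by simp
  qed simp
  ultimately show False using assms(7) by simp
qed

lemma exponent_power_of_two:
  assumes "0 < a" "a < n" "even a"
  obtains f where "a = 2 ^ f"
proof -
  obtain x where "[a * x = 1] (mod n)"
    using cong_solve_coprime_nat[OF coprime_a] by auto
  then have "[a * (x mod n) = 1] (mod n)"
    by (simp add: cong_def mod_mult_right_eq)
  moreover have "x mod n < n" by (simp add: n_def)
  ultimately obtain b0 where b0: "[a * b0 = 1] (mod n)" "b0 < n" by blast
  have "b0 > 0"
    using b0(1) q_ge by (auto intro!: Nat.gr0I simp: cong_def n_def)
  have "odd b0"
  proof
    assume ev: "even b0"
    have "t ^ 0 * (t ^ (a * b0) + 1) = t + 1" if "t \<in> U" for t
      using roots_U_power_cong[OF that b0(1)] by simp
    \<comment> \<open>With \<open>e = 0\<close> and \<open>i = j = 0\<close> this would deny that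
      \<open>n\<close> divides 0.\<close>
    from not_dvd_exponents[OF assms(2) b0(2) assms(3) ev this assms(1) \<open>b0 > 0\<close>]
    show False by simp
  qed
  define b where "b = n - b0"
  have ev: "even b" and bn: "b < n"
    using \<open>odd b0\<close> b0(2) \<open>b0 > 0\<close> even_q by (auto simp: b_def n_def)
  have dvd: "n dvd a * b + 1"
  proof -
    have "[int (a * b) + 1 = int a * (int n - int b0) + 1] (mod int n)"
      using b0(2) by (simp add: b_def of_nat_diff)
    also have "int a * (int n - int b0) + 1 = int a * int n + (1 - int (a * b0))"
      by (simp add: algebra_simps)
    also have "[\<dots> = 0 + (1 - 1)] (mod int n)"
      using b0(1) by (intro cong_add cong_diff) (auto simp: cong_0_iff simp flip: cong_int_iff)
    finally have "int n dvd int (a * b + 1)"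
      by (simp add: cong_0_iff add.commute)
    then show ?thesis by (simp only: int_dvd_int_iff)
  qed
  have e: "t ^ 1 * (t ^ (a * b) + 1) = t + 1" if "t \<in> U" for t
    using roots_U_power_cong[OF that, of "a * b + 1" 0] dvd
    by (simp add: cong_0_iff algebra_simps)
  have "a * b < n"
  proof (rule ccontr)
    assume "\<not> a * b < n"
    \<comment> \<open>Division by \<open>a\<close> writes \<open>n - 1\<close> as
      \<open>i + a * j\<close> with \<open>i < a\<close>. Then \<open>j < b\<close>, and
      \<open>1 + i + a * j\<close> is \<open>n\<close> itself.\<close>
    then have "(n - 1) div a < b"
      using assms by (simp add: less_mult_imp_div_less div_less_iff_less_mult mult.commute n_def)
    from not_dvd_exponents[OF assms(2) bn assms(3) ev e _ this, of "(n - 1) mod a"] assms(1)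
    have "\<not> n dvd 1 + (n - 1)"
      by (simp add: add.assoc)
    then show False by (simp add: n_def)
  qed
  with dvd have "a * b + 1 = n"
    by (metis Suc_eq_plus1 Suc_leI dvd_imp_le le_antisym zero_less_Suc)
  then have "a dvd 2 ^ m"
    by (metis add_right_cancel dvd_triv_left n_def q_def)
  then obtain f where "a = 2 ^ f"
    using divides_primepow_nat[of 2 a m] two_is_prime_nat by auto
  then show ?thesis using that by blast
qed

text \<open>The additive map sending \<open>u\<close> to \<open>u ^ a + u\<close> kills the subfield
  of order \<open>2 ^ d\<close>, where \<open>d = gcd f m\<close>. If \<open>d > 1\<close>, it
  therefore takes the same value \<open>c\<close> at three elements of trace 1. With
  \<open>u = 1 / (t + 1)\<close> the condition \<open>u ^ a + u = c\<close> becomes the equation of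
  a plane that also contains the point with parameter 1.\<close>

lemma exponent_coprime:
  assumes "a = 2 ^ f"
  shows "coprime f m"
proof (rule ccontr)
  define d where "d = gcd f m"
  assume "\<not> coprime f m"
  then have "d \<noteq> 1" "d \<noteq> 0"
    using m_ge by (auto simp: d_def coprime_iff_gcd_eq_1)
  then have "d \<ge> 2" by simp
  have dvd: "d dvd f" "d dvd m" by (simp_all add: d_def)
  \<comment> \<open>The field has \<open>2 ^ (m * 2)\<close> elements, so \<open>2 ^ d - 1\<close>
    divides the order of its multiplicative group.\<close>
  obtain k where k: "m * 2 = d * k" using dvd by (meson dvd_def dvd_mult2)
  have "(2::int) ^ d - 1 dvd (2 ^ d) ^ k - 1"
    by (metis power_diff_1_eq dvd_triv_left)
  then have "int (2 ^ d - 1) dvd int (CARD('k) - 1)"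
    by (simp add: card_field q_def of_nat_diff k flip: power_mult)
  then obtain d' where "CARD('k) - 1 = (2 ^ d - 1) * d'"
    unfolding int_dvd_int_iff by (auto simp: dvd_def)
  then have "card (roots_U (2 ^ d - 1) :: 'k set) = 2 ^ d - 1"
    by (rule card_roots_U)
  moreover have "(2::nat) ^ d - 1 > 1"
    using power_increasing[OF \<open>d \<ge> 2\<close>, of "2::nat"] by simp
  ultimately have "\<not> roots_U (2 ^ d - 1) \<subseteq> {1::'k}"
    using card_mono[of "{1::'k}" "roots_U (2 ^ d - 1)"] by auto
  then obtain w :: 'k where w: "w \<noteq> 0" "w \<noteq> 1" "w ^ (2 ^ d - 1) = 1"
    by (auto simp: roots_U_def)
  then have wd: "w ^ (2 ^ d) = w"
    by (metis Suc_diff_1 mult.right_neutral power_Suc zero_less_numeral zero_less_power)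
  have wi: "w ^ (2 ^ i) = w" if dvd_i: "d dvd i" for i
  proof -
    obtain j where "i = d * j" using dvd_i by (rule dvdE)
    moreover have "w ^ ((2 ^ d) ^ j) = w"
      by (induction j) (simp_all add: power_mult wd)
    ultimately show ?thesis by (simp add: power_mult)
  qed
  have wq: "w ^ q = w" and wa: "w ^ a = w"
    using wi dvd by (simp_all add: q_def assms)
  obtain l :: 'k where l: "l ^ q = l + 1" by (rule obtain_trace_one)
  let ?V = "{l, l + 1, l + w}"
  let ?g = "\<lambda>u::'k. 1 + 1 / u"
  have tr: "u ^ q = u + 1" and fr: "u ^ a + u = l ^ a + l" if "u \<in> ?V" for u
    using that l wq wa by (auto simp: power_q_add frobenius_add assms ac_simps)
  define c where "c = l + l ^ a"
  \<comment> \<open>These are the coefficients of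
    \<open>(t ^ a + 1) + (t + 1) + c * ((t + 1) * (t ^ a + 1))\<close>; \<open>c\<close> and
    \<open>1 + c\<close> cannot both be 0.\<close>
  have "(1 + 1 + c) = 0 \<and> 1 + c = 0 \<and> 1 + c = 0 \<and> c = 0"
  proof (rule four_coplanarD)
    show "insert 1 (?g ` ?V) \<subseteq> U"
      using trace_one_in_U(1)[OF tr] by auto
    have "inj_on ?g ?V" by (auto simp: inj_on_def)
    then have "card (?g ` ?V) = card ?V" by (rule card_image)
    moreover have "card ?V = 3" using w by auto
    moreover have "1 \<notin> ?g ` ?V" 
      by (rule notI, erule imageE) (metis trace_one_in_U(2)[OF tr])
    ultimately show "card (insert 1 (?g ` ?V)) = 4" by simp
  next
    fix t assume "t \<in> insert 1 (?g ` ?V)"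
    then consider "t = 1" | u where "u \<in> ?V" "t = ?g u" by blast
    then show "(1 + 1 + c) + (1 + c) * t + (1 + c) * t ^ a + c * t ^ (a + 1) = 0"
    proof cases
      case 2
      have u: "u \<noteq> 0" using trace_one_in_U(3)[OF tr[OF 2(1)]] .
      have ta: "t ^ a = 1 + 1 / u ^ a"
        by (simp add: 2(2) assms frobenius_add power_divide)
      have t1: "t + 1 = 1 / u" and ta1: "t ^ a + 1 = 1 / u ^ a"
        unfolding ta by (simp_all add: 2(2) ac_simps)
      have frac: "1 / y + 1 / x + c * (1 / x * (1 / y)) = (y + x + c) / (x * y)"
        if "x \<noteq> 0" "y \<noteq> 0" for x y :: 'k
        using that by (simp add: field_simps)
      have "(1 + 1 + c) + (1 + c) * t + (1 + c) * t ^ a + c * t ^ (a + 1) =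
          (t ^ a + 1) + (t + 1) + c * ((t + 1) * (t ^ a + 1))"
        by (simp add: algebra_simps)
      also have "\<dots> = 1 / u ^ a + 1 / u + c * (1 / u * (1 / u ^ a))"
        by (simp only: t1 ta1)
      also have "\<dots> = (u ^ a + u + c) / (u * u ^ a)"
        by (rule frac) (use u in auto)
      also have "\<dots> = 0"
        using fr[OF 2(1)] by (simp add: c_def ac_simps)
      finally show ?thesis .
    qed (simp add: algebra_simps)
  qed
  then show False by auto
qed

end

section \<open>Transfer between the arc and its coordinates\<close>

lemma sum_power_q:
  fixes g :: "4 \<Rightarrow> 'k"
  shows "(\<Sum>i\<in>UNIV. g i) ^ q = (\<Sum>i\<in>UNIV. g i ^ q)"
  by (simp add: sum_4 power_q_add)

lemma monomial_set_nat:
  "monomial_set n (int a) = (\<lambda>t. proj_point (vector [1, t, t ^ a, t ^ (a + 1)])) ` U"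
proof -
  have "t powi (int a + 1) = t ^ (a + 1)" for t :: 'k
    by (metis of_nat_1 of_nat_add power_int_of_nat)
  then show ?thesis by (auto simp: monomial_set_def)
qed

text \<open>
  A plane over the big field that contains points over the subfield can be replaced by a plane over
  the subfield, whose coefficients are the traces of a suitable multiple of the given ones.
\<close>

lemma arc_imp_no_four_coplanar:
  assumes arc: "is_arc Fq (q + 1) S" and equiv: "proj_equiv (monomial_set n (int a)) S"
  shows "no_four_coplanar a"
  unfolding no_four_coplanar_def
proof (intro allI impI, rule ccontr)
  fix T and c0 c1 c2 c3 :: 'k
  assume T: "T \<subseteq> U" "card T = 4"
    and "\<forall>t\<in>T. c0 + c1 * t + c2 * t ^ a + c3 * t ^ (a + 1) = 0"
    and nz: "\<not> (c0 = 0 \<and> c1 = 0 \<and> c2 = 0 \<and> c3 = 0)"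
  then have zero: "c0 + c1 * t + c2 * t ^ a + c3 * t ^ (a + 1) = 0" if "t \<in> T" for t
    using that by blast
  define v :: "'k \<Rightarrow> 'k ^ 4" where "v t = vector [1, t, t ^ a, t ^ (a + 1)]" for t
  define c :: "'k ^ 4" where "c = vector [c0, c1, c2, c3]"
  obtain A :: "'k ^ 4 ^ 4" where A: "invertible A" "S = (\<lambda>P. (\<lambda>x. A *v x) ` P) ` monomial_set n (int a)"
    using equiv by (auto simp: proj_equiv_def)
  obtain B where B: "B ** A = mat 1" "A ** B = mat 1" using A(1) by (auto simp: invertible_def)
  have S: "S = (\<lambda>t. proj_point (A *v v t)) ` U"
    by (simp add: A(2) monomial_set_nat image_image image_proj_point v_def)
  define w where "w = c v* B"
  have wA: "w v* A = c"
    by (simp add: w_def vector_matrix_mul_assoc B)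
  have "c \<noteq> 0" using nz by (auto simp: c_def vec4_eq_iff)
  then have "w \<noteq> 0" using wA by auto
  then obtain j where j: "w $ j \<noteq> 0" by (auto simp: vec_eq_iff)
  obtain l :: 'k where l: "l ^ q = l + 1" by (rule obtain_trace_one)
  \<comment> \<open>The scaling turns the coefficient at \<open>j\<close> into \<open>l\<close>,
    whose trace is 1, so the vector \<open>w'\<close> of traces is nonzero.\<close>
  define k where "k = l / w $ j"
  define w' :: "'k ^ 4" where "w' = (\<chi> i. k * w $ i + (k * w $ i) ^ q)"
  have "w' $ j = 1" using j l by (simp add: w'_def k_def)
  then have "w' \<noteq> 0" by auto
  moreover have "w' $ i \<in> Fq" for i
    using power_field_card[of "k * w $ i"]
    by (simp add: w'_def subfield_q_def power_q_add power2_eq_square power_mult ac_simps)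
  ultimately have plane: "{P \<in> PG3 Fq. \<forall>x\<in>P. (\<Sum>i\<in>UNIV. w' $ i * x $ i) = 0} \<in> PG3_planes Fq"
    unfolding PG3_planes_def by blast
  have inj: "inj_on (\<lambda>t. proj_point (A *v v t)) U"
  proof (rule inj_onI)
    fix x y assume "proj_point (A *v v x) = proj_point (A *v v y)"
    then have "(\<lambda>z. B *v z) ` proj_point (A *v v x) = (\<lambda>z. B *v z) ` proj_point (A *v v y)"
      by simp
    then have "proj_point (v x) = proj_point (v y)"
      by (simp add: image_proj_point matrix_vector_mul_assoc B)
    then have "v x = v y"
      by (rule proj_point_normalized_inj[where i = 1]) (simp_all add: v_def)
    then show "x = y" by (simp add: v_def vec4_eq_iff)
  qed
  let ?T = "(\<lambda>t. proj_point (A *v v t)) ` T"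
  have "?T \<subseteq> S" using S T(1) by auto
  moreover have "card ?T = 4"
    using card_image[OF inj_on_subset[OF inj T(1)]] T(2) by simp
  moreover have "?T \<subseteq> {P \<in> PG3 Fq. \<forall>x\<in>P. (\<Sum>i\<in>UNIV. w' $ i * x $ i) = 0}"
  proof
    fix P assume "P \<in> ?T"
    then obtain t where t: "t \<in> T" "P = proj_point (A *v v t)" by blast
    have "P \<in> PG3 Fq"
      using \<open>P \<in> ?T\<close> \<open>?T \<subseteq> S\<close> arc by (auto simp: is_arc_def)
    then obtain p where p: "P = proj_point p" "\<forall>i. p $ i \<in> Fq" by (auto simp: PG3_def)
    have "(\<Sum>i\<in>UNIV. w $ i * (A *v v t) $ i) = (\<Sum>i\<in>UNIV. (w v* A) $ i * v t $ i)"
      by (simp add: sum_4 matrix_vector_mult_def vector_matrix_mult_def algebra_simps)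
    also have "\<dots> = 0"
      using zero[OF t(1)] by (simp add: wA c_def v_def sum_4)
    finally have "\<forall>x\<in>P. (\<Sum>i\<in>UNIV. w $ i * x $ i) = 0"
      unfolding t(2) proj_point_in_plane_iff .
    then have "(\<Sum>i\<in>UNIV. w $ i * p $ i) = 0"
      unfolding p(1) proj_point_in_plane_iff .
    then have wp: "(\<Sum>i\<in>UNIV. k * w $ i * p $ i) = 0"
      by (simp add: mult.assoc flip: sum_distrib_left)
    \<comment> \<open>As \<open>p\<close> has coordinates in the subfield, this is the trace of the
      vanishing sum in \<open>wp\<close>.\<close>
    have "(\<Sum>i\<in>UNIV. w' $ i * p $ i) =
        (\<Sum>i\<in>UNIV. k * w $ i * p $ i) + (\<Sum>i\<in>UNIV. (k * w $ i * p $ i) ^ q)"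
      using p(2) by (simp add: w'_def subfield_q_def power_mult_distrib distrib_right sum.distrib)
    also have "\<dots> = 0"
      unfolding sum_power_q[symmetric] wp using q_ge by (simp add: power_0_left)
    finally show "P \<in> {P \<in> PG3 Fq. \<forall>x\<in>P. (\<Sum>i\<in>UNIV. w' $ i * x $ i) = 0}"
      using \<open>P \<in> PG3 Fq\<close> by (simp add: p(1) proj_point_in_plane_iff)
  qed
  ultimately show False
    using arc plane unfolding is_arc_def by blast
qed

lemma monomial_set_cong:
  assumes "[a = b] (mod int n)"
  shows "monomial_set n a = (monomial_set n b :: ('k ^ 4) set set)"
proof -
  have "[a + 1 = b + 1] (mod int n)"
    using assms by (simp add: cong_add_rcancel)
  then show ?thesis
    unfolding monomial_set_def Setcompr_eq_image
    by (intro image_cong refl) (simp add: roots_U_powi_cong[OF _ assms] roots_U_powi_cong)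
qed

text \<open>Multiplying the coordinates of a point by \<open>t powi a\<close> gives
  \<open>t powi a\<close>, \<open>t powi (a + 1)\<close>, 1, \<open>t\<close>; it remains to
  exchange the two halves.\<close>

lemma proj_equiv_monomial_set_uminus:
  "proj_equiv (monomial_set n (- a)) (monomial_set n a :: ('k ^ 4) set set)"
proof -
  define A :: "'k ^ 4 ^ 4" where "A = vector
    [vector [0, 0, 1, 0], vector [0, 0, 0, 1], vector [1, 0, 0, 0], vector [0, 1, 0, 0]]"
  have A: "A *v x = vector [x $ 3, x $ 4, x $ 1, x $ 2]" for x
    by (simp add: A_def vec4_eq_iff matrix_vector_mult_def sum_4)
  have "A *v (A *v x) = x" for x
    by (simp add: A vec4_eq_iff)
  then have "A ** A = mat 1"
    by (simp add: matrix_eq matrix_vector_mul_assoc)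
  then have inv: "invertible A" by (auto simp: invertible_def)
  have pt: "(\<lambda>x. A *v x) ` proj_point (vector [1, t, t powi (- a), t powi (- a + 1)]) =
      proj_point (vector [1, t, t powi a, t powi (a + 1)])" if "t \<in> U" for t
  proof -
    have t: "t \<noteq> 0" using that by (rule U_nonzero)
    then have "A *v vector [1, t, t powi (- a), t powi (- a + 1)] =
        t powi (- a) *s vector [1, t, t powi a, t powi (a + 1)]"
      by (simp add: A vec4_eq_iff power_int_minus power_int_add power_int_diff field_simps)
    then show ?thesis
      using t by (simp add: image_proj_point proj_point_scale)
  qed
  have "monomial_set n a = (\<lambda>P. (\<lambda>x. A *v x) ` P) ` monomial_set n (- a)"
    unfolding monomial_set_def Setcompr_eq_image image_image
    by (rule image_cong) (use pt in auto)
  then show ?thesis using inv unfolding proj_equiv_def by blast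
qed

section \<open>The arcs of Frobenius type\<close>

text \<open>Differences \<open>d\<close> and \<open>d'\<close> of zeros both satisfy
  \<open>c1 * d = c2 * d ^ (2 ^ f)\<close>. If \<open>c2\<close> is nonzero, their quotient is fixed
  by the Frobenius powers with exponents \<open>f\<close> and \<open>m\<close>, hence by squaring,
  as \<open>f\<close> and \<open>m\<close> are coprime. So the quotient is 1, although
  \<open>d\<close> and \<open>d'\<close> are distinct.\<close>

lemma affine_frobenius_roots:
  assumes f: "coprime f m" and X: "X \<subseteq> Fq" "card X \<ge> 3"
    and zero: "\<And>x. x \<in> X \<Longrightarrow> c0 + c1 * x + c2 * x ^ (2 ^ f) = 0"
  shows "c0 = 0 \<and> c1 = 0 \<and> c2 = (0::'k)"
proof -
  obtain Y where "Y \<subseteq> X" "card Y = 3"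
    using obtain_subset_with_card_n[OF X(2)] by metis
  then obtain x y z where xyz: "x \<in> X" "y \<in> X" "z \<in> X" "x \<noteq> y" "y \<noteq> z" "x \<noteq> z"
    unfolding card_3_iff by auto
  define d where "d = x + y"
  define d' where "d' = x + z"
  have nz: "d \<noteq> 0" "d' \<noteq> 0" "d \<noteq> d'"
    using xyz by (auto simp: d_def d'_def add_eq_0_iff_eq)
  have diff: "c1 * (s + t) = c2 * (s + t) ^ (2 ^ f)" if "s \<in> X" "t \<in> X" for s t
  proof -
    have "c1 * (s + t) + c2 * (s + t) ^ (2 ^ f) =
        (c0 + c1 * s + c2 * s ^ (2 ^ f)) + (c0 + c1 * t + c2 * t ^ (2 ^ f))"
      unfolding frobenius_add by (simp add: algebra_simps)
    then show ?thesis
      using zero that by (simp add: add_eq_0_iff_eq)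
  qed
  have e: "c1 * d = c2 * d ^ (2 ^ f)" "c1 * d' = c2 * d' ^ (2 ^ f)"
    using diff xyz by (auto simp: d_def d'_def)
  have c2: "c2 = 0"
  proof (rule ccontr)
    assume c2: "c2 \<noteq> 0"
    define r where "r = d / d'"
    have "c2 * (d ^ (2 ^ f) * d') = c2 * (d' ^ (2 ^ f) * d)"
      using e by (metis mult.assoc mult.commute)
    then have "d ^ (2 ^ f) * d' = d' ^ (2 ^ f) * d" using c2 by simp
    then have rf: "r ^ (2 ^ f) = r"
      using nz by (simp add: r_def power_divide frac_eq_eq mult.commute)
    have "r \<in> Fq"
      using X(1) xyz by (auto simp: r_def d_def d'_def intro!: Fq_divide Fq_add)
    then have rq: "r ^ (2 ^ m) = r" by (simp add: subfield_q_def q_def)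
    have iter: "r ^ (2 ^ (i * j)) = r" if "r ^ (2 ^ i) = r" for i j
      using that by (induction j) (simp_all add: power_add power_mult)
    have "f \<noteq> 0" using f m_ge by (auto intro!: Nat.gr0I)
    then obtain i j where "f * i = m * j + 1"
      using bezout_nat[of f m] f by (auto simp: coprime_iff_gcd_eq_1)
    then have "r = r ^ (2 ^ (m * j + 1))"
      using iter[OF rf, of i] by simp
    also have "\<dots> = (r ^ (2 ^ (m * j))) ^ 2"
      by (simp add: power_mult[symmetric] mult.commute)
    also have "\<dots> = r ^ 2" by (simp add: iter[OF rq])
    finally have "r * r = r * 1" by (simp add: power2_eq_square)
    moreover have "r \<noteq> 0" using nz by (simp add: r_def)
    ultimately have "r = 1" by simp
    then show False using nz by (simp add: r_def)
  qed
  moreover have "c1 = 0" using e(1) nz c2 by simp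
  ultimately show ?thesis using zero[OF xyz(1)] by simp
qed

text \<open>
  Moving one of the parameters to infinity by an inversion turns the equation of the plane into an
  affine one.
\<close>

lemma bilinear_frobenius_roots:
  assumes f: "coprime f m" and X: "X \<subseteq> Fq" "card X \<ge> 4"
    and zero: "\<And>t. t \<in> X \<Longrightarrow> c0 + c1 * t + c2 * t ^ (2 ^ f) + c3 * (t ^ (2 ^ f) * t) = 0"
  shows "c0 = 0 \<and> c1 = 0 \<and> c2 = 0 \<and> c3 = (0::'k)"
proof -
  obtain s where s: "s \<in> X" using X(2) by fastforce
  define g where "g t = 1 / (t + s)" for t
  have inj: "inj_on g (X - {s})"
    by (auto simp: inj_on_def g_def)
  \<comment> \<open>These coefficients arise by putting \<open>t = s + 1 / x\<close>, subtracting
    the equation at \<open>s\<close> and dividing by \<open>(t + s) ^ (2 ^ f + 1)\<close>.\<close>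
  have "c3 = 0 \<and> c2 + c3 * s = 0 \<and> c1 + c3 * s ^ (2 ^ f) = 0"
  proof (rule affine_frobenius_roots[OF f])
    show "g ` (X - {s}) \<subseteq> Fq"
      using X(1) s by (auto simp: g_def intro!: Fq_divide Fq_add)
    show "3 \<le> card (g ` (X - {s}))"
      using X(2) s by (simp add: card_image[OF inj])
    fix x assume "x \<in> g ` (X - {s})"
    then obtain t where t: "t \<in> X" "t \<noteq> s" "x = 1 / (t + s)" by (auto simp: g_def)
    define d where "d = t + s"
    define F where "F = d ^ (2 ^ f)"
    define G where "G = s ^ (2 ^ f)"
    have d: "d \<noteq> 0" "F \<noteq> 0" using t by (auto simp: d_def F_def add_eq_0_iff_eq)
    have tf: "t ^ (2 ^ f) = F + G"
      by (simp add: F_def d_def G_def frobenius_add ac_simps)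
    have td: "t = d + s" by (simp add: d_def ac_simps)
    have "c0 + c1 * (d + s) + c2 * (F + G) + c3 * ((F + G) * (d + s)) = 0"
      using zero[OF t(1)] unfolding tf unfolding td .
    moreover have "c0 + c1 * s + c2 * G + c3 * (G * s) = 0"
      using zero[OF s] by (simp add: G_def)
    ultimately have "(c0 + c1 * (d + s) + c2 * (F + G) + c3 * ((F + G) * (d + s))) +
        (c0 + c1 * s + c2 * G + c3 * (G * s)) = 0" by simp
    then have "c3 * (F * d) + (c2 + c3 * s) * F + (c1 + c3 * G) * d = 0"
      by (simp add: algebra_simps)
    then have "(c3 * (F * d) + (c2 + c3 * s) * F + (c1 + c3 * G) * d) / (F * d) = 0" by simp
    then have "c3 + (c2 + c3 * s) * (1 / d) + (c1 + c3 * G) * (1 / F) = 0"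
      using d by (simp add: add_divide_distrib)
    then show "c3 + (c2 + c3 * s) * x + (c1 + c3 * s ^ (2 ^ f)) * x ^ (2 ^ f) = 0"
      by (simp add: t(3) d_def F_def G_def power_divide)
  qed
  then show ?thesis using zero[OF s] by auto
qed

text \<open>A plane through the point at infinity has last coefficient 0, which leaves an affine
  equation with three zeros; any other plane gives a bilinear equation with four zeros.\<close>

lemma is_arc_arc_A:
  assumes f: "coprime f m" and frob: "\<And>t::'k. frob e t = t ^ (2 ^ f)"
  shows "is_arc Fq (q + 1) (arc_A q e)"
proof -
  define v :: "'k \<Rightarrow> 'k ^ 4" where "v t = vector [1, t, t ^ (2 ^ f), t ^ (2 ^ f) * t]" for t
  define P where "P t = proj_point (v t)" for t
  define inf where "inf = proj_point (vector [0, 0, 0, 1] :: 'k ^ 4)"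
  have S: "arc_A q e = insert inf (P ` Fq)"
    by (auto simp: arc_A_def P_def v_def inf_def frob)
  have v1: "v t $ 1 = 1" for t by (simp add: v_def)
  have inj: "inj_on P Fq"
  proof (rule inj_onI)
    fix x y assume "P x = P y"
    then have "v x = v y"
      unfolding P_def by (rule proj_point_normalized_inj[OF _ v1 v1])
    then show "x = y" by (simp add: v_def vec4_eq_iff)
  qed
  have inf: "inf \<notin> P ` Fq"
  proof
    assume "inf \<in> P ` Fq"
    then obtain t where "inf = P t" by blast
    then have "v t \<in> inf"
      by (simp add: P_def proj_point_def vec.span_base)
    then obtain c where "v t = c *s vector [0, 0, 0, 1]"
      by (auto simp: inf_def proj_point_eq_range)
    then have "v t $ 1 = 0" by simp
    then show False by (simp add: v1)
  qed
  have "arc_A q e \<subseteq> PG3 Fq"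
  proof -
    have "P t \<in> PG3 Fq" if "t \<in> Fq" for t
    proof -
      have "v t \<noteq> 0" using v1[of t] by auto
      moreover have "\<forall>i. v t $ i \<in> Fq"
        using that by (simp add: forall_4 v_def Fq_power Fq_mult)
      ultimately show ?thesis unfolding PG3_def P_def by blast
    qed
    moreover have "inf \<in> PG3 Fq"
      unfolding PG3_def inf_def by (auto simp: forall_4 vec4_eq_iff intro!: exI[of _ "vector [0, 0, 0, 1]"])
    ultimately show ?thesis by (auto simp: S)
  qed
  moreover have "card (arc_A q e :: ('k ^ 4) set set) = q + 1"
    using inf by (simp add: S card_image[OF inj] card_Fq)
  moreover have "\<not> (\<exists>H\<in>PG3_planes Fq. T \<subseteq> H)" if T: "T \<subseteq> arc_A q e" "card T = 4" for T
  proof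
    assume "\<exists>H\<in>PG3_planes Fq. T \<subseteq> H"
    then obtain u where u: "u \<noteq> 0"
      "T \<subseteq> {P \<in> PG3 Fq. \<forall>x\<in>P. (\<Sum>i\<in>UNIV. u $ i * x $ i) = 0}"
      unfolding PG3_planes_def by blast
    define X where "X = {t \<in> Fq. P t \<in> T}"
    have XF: "X \<subseteq> Fq" by (auto simp: X_def)
    have zero: "u $ 1 + u $ 2 * t + u $ 3 * t ^ (2 ^ f) + u $ 4 * (t ^ (2 ^ f) * t) = 0" if "t \<in> X" for t
    proof -
      have "\<forall>x\<in>P t. (\<Sum>i\<in>UNIV. u $ i * x $ i) = 0"
        using u(2) that by (auto simp: X_def)
      then show ?thesis
        unfolding P_def proj_point_in_plane_iff by (simp add: sum_4 v_def)
    qed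
    have TX: "T - {inf} = P ` X" using T(1) inf by (auto simp: S X_def)
    then have cX: "card X = card (T - {inf})"
      using card_image[OF inj_on_subset[OF inj XF]] by simp
    have "u $ 1 = 0 \<and> u $ 2 = 0 \<and> u $ 3 = 0 \<and> u $ 4 = 0"
    proof (cases "inf \<in> T")
      case True
      then have "\<forall>x\<in>inf. (\<Sum>i\<in>UNIV. u $ i * x $ i) = 0"
        using u(2) by auto
      then have u4: "u $ 4 = 0"
        unfolding inf_def proj_point_in_plane_iff by (simp add: sum_4)
      have "u $ 1 = 0 \<and> u $ 2 = 0 \<and> u $ 3 = 0"
      proof (rule affine_frobenius_roots[OF f XF])
        show "3 \<le> card X" using True T(2) by (simp add: cX)
        show "u $ 1 + u $ 2 * x + u $ 3 * x ^ (2 ^ f) = 0" if "x \<in> X" for x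
          using zero[OF that] u4 by simp
      qed
      then show ?thesis using u4 by simp
    next
      case False
      show ?thesis
      proof (rule bilinear_frobenius_roots[OF f XF])
        show "4 \<le> card X" using False T(2) by (simp add: cX)
      qed (rule zero)
    qed
    then show False using u(1) by (simp add: vec4_eq_iff)
  qed
  ultimately show ?thesis unfolding is_arc_def by simp
qed

text \<open>
  The point with parameter t is the tensor product of (1,t) and (1,s), where s is the image of t
  under the Frobenius map. The matrix is the tensor product of the matrices of the substitution
  sending t to 1/(t+1) + l, which maps U to the projective line over the subfield, and of its
  Frobenius conjugate.
\<close>

lemma proj_equiv_monomial_arc_A:
  assumes frob: "\<And>t::'k. frob e t = t ^ (2 ^ f)"
  shows "proj_equiv (monomial_set n (int (2 ^ f))) (arc_A q e :: ('k ^ 4) set set)"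
proof -
  define F where "F t = t ^ (2 ^ f)" for t :: 'k
  have F_add: "F (s + t) = F s + F t" and F_mult: "F (s * t) = F s * F t"
    and F_div: "F (s / t) = F s / F t" and F_1: "F 1 = 1" for s t
    by (simp_all add: F_def frobenius_add power_mult_distrib power_divide)
  obtain l :: 'k where l: "l ^ q = l + 1" by (rule obtain_trace_one)
  \<comment> \<open>The first tensor factor sends \<open>(1, t)\<close> to
    \<open>(1 + t, (1 + l) + l * t)\<close>; the second is the same with \<open>F l\<close> and
    \<open>F t\<close>.\<close>
  define A :: "'k ^ 4 ^ 4" where "A = vector
    [vector [1, 1, 1, 1],
     vector [1 + l, l, 1 + l, l],
     vector [1 + F l, 1 + F l, F l, F l],
     vector [(1 + l) * (1 + F l), l * (1 + F l), (1 + l) * F l, l * F l]]"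
  define v :: "'k \<Rightarrow> 'k ^ 4" where "v t = vector [1, t, F t, F t * t]" for t
  define P where "P t = proj_point (v t)" for t
  have "x = 0" if "A *v x = 0" for x
  proof -
    have r1: "x $ 1 + x $ 2 + x $ 3 + x $ 4 = 0"
      and r2: "(1 + l) * x $ 1 + l * x $ 2 + (1 + l) * x $ 3 + l * x $ 4 = 0"
      and r3: "(1 + F l) * x $ 1 + (1 + F l) * x $ 2 + F l * x $ 3 + F l * x $ 4 = 0"
      and r4: "(1 + l) * (1 + F l) * x $ 1 + l * (1 + F l) * x $ 2 + (1 + l) * F l * x $ 3
          + l * F l * x $ 4 = 0"
      using that by (simp_all add: A_def vec4_eq_iff matrix_vector_mult_def sum_4)
    have "(1 + l) * x $ 1 + l * x $ 2 + (1 + l) * x $ 3 + l * x $ 4 =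
        x $ 1 + x $ 3 + l * (x $ 1 + x $ 2 + x $ 3 + x $ 4)"
      by (simp add: algebra_simps)
    then have x3: "x $ 3 = x $ 1" using r1 r2 by (simp add: add_eq_0_iff_eq)
    have "(1 + F l) * x $ 1 + (1 + F l) * x $ 2 + F l * x $ 3 + F l * x $ 4 =
        x $ 1 + x $ 2 + F l * (x $ 1 + x $ 2 + x $ 3 + x $ 4)"
      by (simp add: algebra_simps)
    then have x2: "x $ 2 = x $ 1" using r1 r3 by (simp add: add_eq_0_iff_eq)
    have x4: "x $ 4 = x $ 1" using r1 by (simp add: x2 x3 add_eq_0_iff_eq)
    have "x $ 1 = 0" using r4 by (simp add: x2 x3 x4 algebra_simps)
    then show ?thesis by (simp add: vec4_eq_iff x2 x3 x4)
  qed
  then have inv: "invertible A"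
    by (simp add: invertible_left_inverse matrix_left_invertible_ker)
  have one: "proj_point (A *v v 1) = proj_point (vector [0, 0, 0, 1])"
  proof -
    have "A *v v 1 = vector [0, 0, 0, 1]"
      by (simp add: A_def v_def F_1 vec4_eq_iff matrix_vector_mult_def sum_4 algebra_simps)
    then show ?thesis by simp
  qed
  have other: "proj_point (A *v v t) = P (1 / (t + 1) + l)" if t: "t \<noteq> 1" for t
  proof -
    define y where "y = t + 1"
    have y: "y \<noteq> 0" "F y \<noteq> 0" using t by (auto simp: y_def F_def add_eq_0_iff_eq)
    have t: "t = y + 1" by (simp add: y_def ac_simps)
    have "A *v v t = vector [y * F y, (1 + l * y) * F y, y * (1 + F l * F y), (1 + l * y) * (1 + F l * F y)]"
      unfolding t
      by (simp add: A_def v_def F_1 F_add vec4_eq_iff matrix_vector_mult_def sum_4 algebra_simps)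
    also have "\<dots> = (y * F y) *s v (1 / y + l)"
      using y by (simp add: v_def vec4_eq_iff F_add F_mult F_div F_1 field_simps)
    finally have "proj_point (A *v v t) = proj_point ((y * F y) *s v (1 / y + l))" by simp
    also have "\<dots> = P (1 / y + l)"
      unfolding P_def by (rule proj_point_scale) (use y in simp)
    finally show ?thesis by (simp add: y_def)
  qed
  \<comment> \<open>Adding \<open>l\<close> turns the coset of elements of trace 1 into the
    subfield.\<close>
  have img: "(\<lambda>t. 1 / (t + 1) + l) ` (U - {1}) = Fq"
  proof (intro equalityI subsetI)
    fix x assume "x \<in> (\<lambda>t. 1 / (t + 1) + l) ` (U - {1})"
    then obtain t where t: "t \<in> U" "t \<noteq> 1" "x = 1 / (t + 1) + l" by auto
    have "x ^ q = (1 / (t + 1) + 1) + (l + 1)"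
      unfolding t(3) power_q_add inverse_U_trace_one[OF t(1,2)] l ..
    then show "x \<in> Fq"
      by (simp add: subfield_q_def t(3) ac_simps)
  next
    fix x assume x: "x \<in> Fq"
    then have "(x + l) ^ q = (x + l) + 1"
      by (simp add: subfield_q_def power_q_add l ac_simps)
    note tr = trace_one_in_U[OF this]
    have "x = 1 / ((1 + 1 / (x + l)) + 1) + l"
      by (simp add: ac_simps)
    then show "x \<in> (\<lambda>t. 1 / (t + 1) + l) ` (U - {1})"
      using tr by (intro image_eqI[of _ _ "1 + 1 / (x + l)"]) auto
  qed
  have "(\<lambda>P. (\<lambda>x. A *v x) ` P) ` monomial_set n (int (2 ^ f)) = (\<lambda>t. proj_point (A *v v t)) ` U"
    by (simp only: monomial_set_nat image_image image_proj_point v_def F_def power_add power_one_right)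
  also have "U = insert 1 (U - {1})" by auto
  also have "(\<lambda>t. proj_point (A *v v t)) ` insert 1 (U - {1}) =
      insert (proj_point (vector [0, 0, 0, 1])) ((\<lambda>t. P (1 / (t + 1) + l)) ` (U - {1}))"
    unfolding image_insert one using other by (intro arg_cong2[where f = insert] image_cong) auto
  also have "(\<lambda>t. P (1 / (t + 1) + l)) ` (U - {1}) = P ` Fq"
    unfolding img[symmetric] image_image ..
  also have "insert (proj_point (vector [0, 0, 0, 1])) (P ` Fq) = arc_A q e"
    by (auto simp: arc_A_def P_def v_def F_def frob)
  finally show ?thesis
    using inv unfolding proj_equiv_def by metis
qed

section \<open>Integer exponents of the Frobenius map\<close>

lemma frobenius_period: "(x::'k) ^ (2 ^ (2 * m * k)) = x"
proof (induction k)
  case (Suc k)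
  have "x ^ (2 ^ (2 * m * Suc k)) = (x ^ (q ^ 2)) ^ (2 ^ (2 * m * k))"
    by (simp add: q_def power_add ac_simps flip: power_mult)
  then show ?case using Suc by (simp add: power_field_card)
qed simp

text \<open>Both the Frobenius map of \<open>'k\<close> and the powers of 2 modulo \<open>n\<close>
  repeat after \<open>2 * m\<close> steps, so one natural exponent can replace \<open>e\<close> in
  the arc and in the congruence.\<close>

definition frob_exp :: "int \<Rightarrow> nat" where
  "frob_exp e = nat (e mod (2 * int m))"

lemma frob_exp_nonneg:
  assumes "0 \<le> e"
  obtains k where "nat e = frob_exp e + 2 * m * k"
proof -
  have "nat e = nat e mod (2 * m) + 2 * m * (nat e div (2 * m))" by simp
  moreover have "frob_exp e = nat e mod (2 * m)"
    using assms by (simp add: frob_exp_def nat_mod_distrib nat_mult_distrib)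
  ultimately show ?thesis using that by metis
qed

lemma frob_exp_neg:
  assumes "e < 0"
  obtains k where "frob_exp e + nat (- e) = 2 * m * k"
proof -
  have "int (frob_exp e + nat (- e)) = e mod (2 * int m) - e"
    using assms m_ge by (simp add: frob_exp_def)
  also have "\<dots> = int (2 * m) * (- (e div (2 * int m)))"
    using mult_div_mod_eq[of "2 * int m" e] by (simp add: algebra_simps)
  finally have "int (2 * m) dvd int (frob_exp e + nat (- e))" by (metis dvd_triv_left)
  then show ?thesis using that unfolding int_dvd_int_iff by (auto elim: dvdE)
qed

text \<open>For negative \<open>e\<close>, \<open>frob_exp e + nat (- e)\<close> is a multiple of
  the period \<open>2 * m\<close>, so the two power maps are mutually inverse.\<close>

lemma frob_eq_power: "frob e (t::'k) = t ^ (2 ^ frob_exp e)"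
proof (cases "0 \<le> e")
  case True
  then obtain k where k: "nat e = frob_exp e + 2 * m * k" by (rule frob_exp_nonneg)
  have "t ^ (2 ^ nat e) = (t ^ (2 ^ frob_exp e)) ^ (2 ^ (2 * m * k))"
    unfolding k power_add power_mult[symmetric] ..
  then show ?thesis using True by (simp add: frob_def frobenius_period)
next
  case False
  then obtain k where k: "frob_exp e + nat (- e) = 2 * m * k" using frob_exp_neg[of e] by auto
  have 1: "(s ^ (2 ^ frob_exp e)) ^ (2 ^ nat (- e)) = s" for s :: 'k
    using frobenius_period[of s k] by (simp only: power_mult[symmetric] power_add[symmetric] k)
  have 2: "(s ^ (2 ^ nat (- e))) ^ (2 ^ frob_exp e) = s" for s :: 'k
    using 1[of s] by (simp only: power_mult[symmetric] mult.commute)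
  have "inj (\<lambda>s::'k. s ^ (2 ^ nat (- e)))"
    using 2 by (rule inj_on_inverseI)
  then have "inv (\<lambda>s::'k. s ^ (2 ^ nat (- e))) t = t ^ (2 ^ frob_exp e)"
    using 1 by (rule inv_f_eq)
  then show ?thesis using False by (simp add: frob_def)
qed

text \<open>Since \<open>2 ^ m = q\<close> is -1 modulo \<open>n\<close>, \<open>2 ^ (2 * m)\<close>
  is 1 modulo \<open>n\<close>.\<close>

lemma two_power_mod_cong: "[two_power_mod n e = 2 ^ frob_exp e] (mod int n)"
proof -
  have "[(2::int) ^ m = - 1] (mod int n)"
    by (simp add: n_def q_def cong_iff_dvd_diff add.commute)
  then have "[((2::int) ^ m) ^ (2 * k) = (- 1) ^ (2 * k)] (mod int n)" for k
    by (rule cong_pow)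
  then have per: "[(2::int) ^ (2 * m * k) = 1] (mod int n)" for k
    by (simp add: ac_simps flip: power_mult)
  show ?thesis
  proof (cases "0 \<le> e")
    case True
    then obtain k where k: "nat e = frob_exp e + 2 * m * k" by (rule frob_exp_nonneg)
    have "[(2::int) ^ frob_exp e * 2 ^ (2 * m * k) = 2 ^ frob_exp e * 1] (mod int n)"
      by (intro cong_mult cong_refl per)
    then show ?thesis using True by (simp add: two_power_mod_def k power_add)
  next
    case False
    then obtain k where k: "frob_exp e + nat (- e) = 2 * m * k" using frob_exp_neg[of e] by auto
    define i where "i = modular_inverse (int n) 2"
    have "coprime 2 (int n)" using even_q by (simp add: n_def)
    then have i: "[i * 2 = 1] (mod int n)"
      unfolding i_def by (rule cong_modular_inverse2)
    have "[i ^ nat (- e) * 1 = i ^ nat (- e) * 2 ^ (frob_exp e + nat (- e))] (mod int n)"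
      unfolding k by (intro cong_mult cong_refl cong_sym[OF per])
    also have "i ^ nat (- e) * 2 ^ (frob_exp e + nat (- e)) = (i * 2) ^ nat (- e) * 2 ^ frob_exp e"
      by (simp add: power_add power_mult_distrib)
    also have "[\<dots> = 1 ^ nat (- e) * 2 ^ frob_exp e] (mod int n)"
      by (intro cong_mult cong_pow i cong_refl)
    finally show ?thesis using False by (simp add: two_power_mod_def i_def)
  qed
qed

text \<open>Reduction modulo \<open>2 * m\<close> preserves residues modulo
  \<open>m\<close>.\<close>

lemma coprime_frob_exp:
  assumes "gcd e (int m) = 1"
  shows "coprime (frob_exp e) m"
proof -
  have "int (frob_exp e) mod int m = e mod int m"
    using m_ge by (simp add: frob_exp_def mod_mod_cancel)
  then have "gcd (int (frob_exp e)) (int m) = gcd e (int m)"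
    by (metis gcd_red_int)
  then have "gcd (int (frob_exp e)) (int m) = 1" using assms by simp
  then show ?thesis by (simp add: coprime_iff_gcd_eq_1)
qed

section \<open>From arcs to exponents and back\<close>

lemma proj_equiv_arc_imp_exponent:
  assumes a: "coprime a (int n)" and arc: "is_arc Fq (q + 1) S" "proj_equiv (monomial_set n a) S"
  shows "\<exists>e::int. gcd e (int m) = 1 \<and>
    ([a = two_power_mod n e] (mod int n) \<or> [a = - two_power_mod n e] (mod int n))"
proof -
  have main: "\<exists>f. coprime f m \<and> [b = 2 ^ f] (mod int n)"
    if b: "coprime b (int n)" "proj_equiv (monomial_set n b) S" "even (b mod int n)" for b
  proof -
    define r where "r = nat (b mod int n)"
    have r: "int r = b mod int n" by (simp add: r_def n_def)
    have rb: "[int r = b] (mod int n)" by (simp add: r)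
    have "coprime r n"
      using b(1) by (metis cong_imp_coprime cong_sym coprime_int_iff rb)
    have "r < n" using pos_mod_bound[of "int n" b] by (simp add: r_def n_def nat_less_iff)
    have "even r" using b(3) by (metis r even_of_nat)
    have "r > 0"
      using \<open>coprime r n\<close> q_ge by (auto intro!: Nat.gr0I simp: n_def)
    have equiv: "proj_equiv (monomial_set n (int r)) S"
      using b(2) monomial_set_cong[OF rb] by simp
    note * = \<open>coprime r n\<close> arc_imp_no_four_coplanar[OF arc(1) equiv]
    obtain f where f: "r = 2 ^ f"
      using exponent_power_of_two[OF *] \<open>r > 0\<close> \<open>r < n\<close> \<open>even r\<close> by blast
    have "coprime f m" using exponent_coprime[OF * f] by blast
    moreover have "[b = 2 ^ f] (mod int n)"
      using rb by (simp add: f cong_sym)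
    ultimately show ?thesis by blast
  qed
  have "\<exists>f. coprime f m \<and> ([a = 2 ^ f] (mod int n) \<or> [a = - (2 ^ f)] (mod int n))"
  proof (cases "even (a mod int n)")
    case True
    then show ?thesis using main[OF a arc(2)] by blast
  next
    case False
    \<comment> \<open>As \<open>n\<close> is odd, the least residue of \<open>- a\<close> is even
      when that of \<open>a\<close> is odd, and negation is a projective equivalence.\<close>
    then have "a mod int n \<noteq> 0" by auto
    then have "(- a) mod int n = int n - a mod int n"
      by (simp add: zmod_zminus1_eq_if)
    then have "even ((- a) mod int n)" using False even_q by (simp add: n_def)
    moreover have "proj_equiv (monomial_set n (- a)) S"
      using proj_equiv_trans[OF proj_equiv_monomial_set_uminus arc(2)] .
    ultimately obtain f where "coprime f m" "[- a = 2 ^ f] (mod int n)"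
      using main[of "- a"] a by auto
    moreover from this have "[- (- a) = - (2 ^ f)] (mod int n)"
      by (simp only: cong_minus_minus_iff)
    ultimately show ?thesis by auto
  qed
  then obtain f where f: "coprime f m" "[a = 2 ^ f] (mod int n) \<or> [a = - (2 ^ f)] (mod int n)"
    by blast
  have "gcd (int f) (int m) = 1" using f(1) by (simp add: coprime_iff_gcd_eq_1)
  moreover have "two_power_mod n (int f) = 2 ^ f" by (simp add: two_power_mod_def)
  ultimately show ?thesis using f(2) by (intro exI[of _ "int f"]) simp
qed

lemma exponent_imp_proj_equiv_arc_A:
  assumes "[a = two_power_mod n e] (mod int n) \<or> [a = - two_power_mod n e] (mod int n)"
  shows "proj_equiv (monomial_set n a) (arc_A q e :: ('k ^ 4) set set)"
proof -
  let ?p = "int (2 ^ frob_exp e)"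
  have equiv: "proj_equiv (monomial_set n ?p) (arc_A q e :: ('k ^ 4) set set)"
    by (rule proj_equiv_monomial_arc_A[OF frob_eq_power])
  from assms consider "[a = ?p] (mod int n)" | "[a = - ?p] (mod int n)"
  proof
    assume "[a = two_power_mod n e] (mod int n)"
    from cong_trans[OF this two_power_mod_cong] show ?thesis using that by simp
  next
    assume "[a = - two_power_mod n e] (mod int n)"
    moreover have "[- two_power_mod n e = - ?p] (mod int n)"
      using two_power_mod_cong[of e] by (simp add: cong_minus_minus_iff)
    ultimately show ?thesis using that cong_trans by blast
  qed
  then show ?thesis
  proof cases
    case 1
    then show ?thesis using equiv monomial_set_cong[OF 1] by simp
  next
    case 2
    then show ?thesis
      using proj_equiv_trans[OF proj_equiv_monomial_set_uminus equiv] monomial_set_cong[OF 2] by simp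
  qed
qed

end

theorem theorem3p5:
  fixes m q n :: nat and a :: int
  assumes "m \<ge> 3" and "q = 2 ^ m" and "n = q + 1"
    and "CARD('k::{field,finite}) = q ^ 2"
    and "coprime a (int n)"
  defines "M \<equiv> (monomial_set n a :: ('k ^ 4) set set)"
  shows "((\<exists>S. is_arc (subfield_q q) (q + 1) S \<and> proj_equiv M S) \<longleftrightarrow>
          (\<exists>e::int. gcd e (int m) = 1 \<and> proj_equiv M (arc_A q e))) \<and>
         ((\<exists>e::int. gcd e (int m) = 1 \<and> proj_equiv M (arc_A q e)) \<longleftrightarrow>
          (\<exists>e::int. gcd e (int m) = 1 \<and>
             ([a = two_power_mod n e] (mod int n) \<or> [a = - two_power_mod n e] (mod int n))))"
proof -
  interpret quadratic_extension_char_2 m q n "TYPE('k)"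
    by unfold_locales (use assms in auto)
  have arc: "is_arc (subfield_q q) (q + 1) (arc_A q e :: ('k ^ 4) set set)"
    if "gcd e (int m) = 1" for e
    using is_arc_arc_A[OF coprime_frob_exp[OF that] frob_eq_power] .
  have "\<exists>e::int. gcd e (int m) = 1 \<and>
      ([a = two_power_mod n e] (mod int n) \<or> [a = - two_power_mod n e] (mod int n))"
    if "is_arc (subfield_q q) (q + 1) S" "proj_equiv M S" for S
    using proj_equiv_arc_imp_exponent[OF assms(5) that(1)] that(2) unfolding M_def .
  moreover have "proj_equiv M (arc_A q e)"
    if "[a = two_power_mod n e] (mod int n) \<or> [a = - two_power_mod n e] (mod int n)" for e
    using exponent_imp_proj_equiv_arc_A[OF that] unfolding M_def .
  \<comment> \<open>The implications close the cycle (i) to (iii) to (ii) to (i).\<close>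
  ultimately show ?thesis
    using arc by meson
qed

end
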